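(* Let $k\ge 2$ be a fixed integer. Let $\mathcal G$ be a $k$-uniform $D$-regular hypergraph on $n$ vertices, and let $q = (1+o(1))D$ (as $D\to\infty$). If the maximum codegree of $\mathcal G$ satisfies $\Delta_2(\mathcal G) = o(q)$, then the number of proper $q$-edge-colorings of $\mathcal G$ is at most \[ \left((1+o(1))\frac{q}{e^k}\right)^{Dn/k}. \]
   Context: A hypergraph is $k$-uniform if every edge has exactly $k$ vertices, and $D$-regular if every vertex lies in exactly $D$ edges. The codegree of two vertices is the number of edges containing both; $\Delta_2(\mathcal G)$ is the maximum codegree over pairs of distinct vertices. A proper $q$-edge-coloring is an assignment of colors from $\{1,\dots,q\}$ to the edges such that no two edges sharing a vertex receive the same color. *)

theory Defs
  imports Complex_Main "HOL-Library.FuncSet" "HOL-Library.Landau_Symbols"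
begin

definition hypergraph :: "'a set \<Rightarrow> 'a set set \<Rightarrow> bool" where
  "hypergraph V E \<longleftrightarrow> finite V \<and> E \<subseteq> Pow V"

definition uniform_hypergraph :: "nat \<Rightarrow> 'a set set \<Rightarrow> bool" where
  "uniform_hypergraph k E \<longleftrightarrow> (\<forall>e\<in>E. card e = k)"

definition vertex_degree :: "'a set set \<Rightarrow> 'a \<Rightarrow> nat" where
  "vertex_degree E v = card {e \<in> E. v \<in> e}"

definition regular_hypergraph :: "nat \<Rightarrow> 'a set \<Rightarrow> 'a set set \<Rightarrow> bool" where
  "regular_hypergraph D V E \<longleftrightarrow> (\<forall>v\<in>V. vertex_degree E v = D)"

definition codegree :: "'a set set \<Rightarrow> 'a \<Rightarrow> 'a \<Rightarrow> nat" where
  "codegree E u v = card {e \<in> E. u \<in> e \<and> v \<in> e}"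

text \<open>Inserting \<open>0\<close> changes the maximum only when there are fewer than two vertices.\<close>

definition max_codegree :: "'a set \<Rightarrow> 'a set set \<Rightarrow> nat" where
  "max_codegree V E =
     Max (insert 0 {codegree E u v | u v. u \<in> V \<and> v \<in> V \<and> u \<noteq> v})"

text \<open>The extensional function space makes colorings that agree on \<open>E\<close> equal, so that
  the cardinality of this set is the number of colorings.\<close>

definition proper_edge_colorings :: "nat \<Rightarrow> 'a set set \<Rightarrow> ('a set \<Rightarrow> nat) set" where
  "proper_edge_colorings q E =
     {c \<in> E \<rightarrow>\<^sub>E {1..q}. \<forall>e\<in>E. \<forall>f\<in>E. e \<noteq> f \<and> e \<inter> f \<noteq> {} \<longrightarrow> c e \<noteq> c f}"

end

theory Submission
  imports Defs
begin

text \<open>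
  An entropy argument in elementary form. Label the edges and color them greedily in increasing order
  of label, each time choosing uniformly among the colors not yet used on an intersecting edge. Each
  proper coloring \<open>c\<close> arises with probability at least \<open>\<Prod>e. 1 / N e\<close>, where \<open>N e\<close> counts the colors
  of \<open>{1..q}\<close> that are free at \<open>e\<close> when it is reached. These numbers therefore sum to at most \<open>1\<close>, and
  by Jensen's inequality the logarithm of the number of colorings is at most the average over \<open>c\<close> of
  \<open>\<Sum>e. ln (N e)\<close>. Now average over independent uniform labels in \<open>{..<M}\<close>. For all but \<open>o(q)\<close>
  colors \<open>x\<close>, the \<open>k\<close> vertices of \<open>e\<close> lie on \<open>k\<close> distinct edges of color \<open>x\<close>, and \<open>x\<close> is free only if none
  of them precedes \<open>e\<close>. If \<open>e\<close> has label \<open>t\<close> this has probability \<open>((M - t) / M) ^ k\<close>, so by Jensen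
  again the average of \<open>ln (N e)\<close> is at most \<open>ln q + (k / M) * ln (M! / M ^ M) + o(1)\<close>. For large \<open>M\<close>
  this is close to \<open>ln q - k\<close>.
\<close>

section \<open>Greedy weights and the entropy inequality for one fixed labeling\<close>

text \<open>Edges with equal labels do not block each other, which only enlarges the set.\<close>

definition free_colors ::
  "nat \<Rightarrow> 'a set set \<Rightarrow> ('a set \<Rightarrow> 'b::linorder) \<Rightarrow> ('a set \<Rightarrow> nat) \<Rightarrow> 'a set \<Rightarrow> nat set" where
  "free_colors q E l c e =
     {x \<in> {1..q}. \<forall>f\<in>E. f \<noteq> e \<and> f \<inter> e \<noteq> {} \<and> c f = x \<longrightarrow> l e \<le> l f}"

lemma finite_free_colors [simp]: "finite (free_colors q E l c e)"
  by (simp add: free_colors_def)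

lemma finite_edges: "hypergraph V E \<Longrightarrow> finite E"
  unfolding hypergraph_def using finite_subset[of E "Pow V"] by simp

lemma finite_proper_edge_colorings: "finite E \<Longrightarrow> finite (proper_edge_colorings q E)"
  unfolding proper_edge_colorings_def by (rule finite_subset[OF _ finite_PiE[of E "\<lambda>_. {1..q}"]]) auto

lemma own_color_free:
  assumes "c \<in> proper_edge_colorings q E" "e \<in> E"
  shows "c e \<in> free_colors q E l c e"
  using assms by (fastforce simp: proper_edge_colorings_def free_colors_def PiE_iff)

lemma card_free_colors_pos:
  assumes "c \<in> proper_edge_colorings q E" "e \<in> E"
  shows "card (free_colors q E l c e) > 0"
  using own_color_free[OF assms, of l] by (auto simp: card_gt_0_iff)

text \<open>The induction appends an edge \<open>x\<close> of largest label. Such an edge has no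
  label strictly below that of another edge, so it blocks nothing: free sets at the old edges stay
  the same, and every free set depends only on the coloring restricted to the old edges. Summing
  over the color of \<open>x\<close> then cancels the new factor.\<close>

lemma sum_prod_inverse_free_colors_le_1:
  fixes l :: "'a set \<Rightarrow> 'b::linorder"
  assumes "finite E"
  shows "(\<Sum>c\<in>proper_edge_colorings q E. \<Prod>e\<in>E. 1 / real (card (free_colors q E l c e))) \<le> 1"
  using assms
proof (induction E rule: finite_ranking_induct[where f = l])
  case empty
  show ?case by (simp add: proper_edge_colorings_def)
next
  case (insert x E)
  show ?case
  proof (cases "x \<in> E")
    case True
    with insert.IH show ?thesis by (simp add: insert_absorb)
  next
    case False
    let ?w = "\<lambda>c. \<Prod>e\<in>E. 1 / real (card (free_colors q E l c e))"
    let ?T = "SIGMA c : proper_edge_colorings q E. free_colors q E l c x"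
    let ?g = "\<lambda>(c, y::nat). ?w c * (1 / real (card (free_colors q E l c x)))"
    have eq: "free_colors q (insert x E) l c e = free_colors q E l (restrict c E) e"
      if "e \<in> insert x E" for c e
      using that insert.hyps False by (auto simp: free_colors_def)
    have "(\<Sum>c\<in>proper_edge_colorings q (insert x E).
             \<Prod>e\<in>insert x E. 1 / real (card (free_colors q (insert x E) l c e))) \<le> sum ?g ?T"
    \<comment> \<open>A proper coloring is recovered from its restriction and the color of
      \<open>x\<close>. Conversely, a pair in \<open>?T\<close> may give an improper coloring, since
      edges with the label of \<open>x\<close> do not block it; hence an inequality.\<close>
    proof (rule sum_le_included[where i = "\<lambda>(c, y). c(x := y)"])
      show "\<forall>c\<in>proper_edge_colorings q (insert x E). \<exists>p\<in>?T. (case p of (c, y) \<Rightarrow> c(x := y)) = c \<and>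
              (\<Prod>e\<in>insert x E. 1 / real (card (free_colors q (insert x E) l c e))) \<le> ?g p"
      proof
        fix c assume c: "c \<in> proper_edge_colorings q (insert x E)"
        let ?c = "restrict c E"
        have 1: "?c \<in> proper_edge_colorings q E"
          using c by (auto simp: proper_edge_colorings_def PiE_iff)
        have 2: "c x \<in> free_colors q E l ?c x"
          using own_color_free[OF c, of x l] eq[of x c] by simp
        have 3: "?c(x := c x) = c"
          using c False by (auto simp: proper_edge_colorings_def PiE_iff fun_eq_iff extensional_def)
        have 4: "(\<Prod>e\<in>insert x E. 1 / real (card (free_colors q (insert x E) l c e))) = ?g (?c, c x)"
          using insert.hyps False by (simp add: eq mult.commute)
        show "\<exists>p\<in>?T. (case p of (c, y) \<Rightarrow> c(x := y)) = c \<and>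
              (\<Prod>e\<in>insert x E. 1 / real (card (free_colors q (insert x E) l c e))) \<le> ?g p"
          using 1 2 3 4 by (intro bexI[of _ "(?c, c x)"]) auto
      qed
    qed (use insert.hyps in \<open>auto intro!: finite_SigmaI finite_proper_edge_colorings
                                mult_nonneg_nonneg prod_nonneg divide_nonneg_nonneg\<close>)
    also have "sum ?g ?T = (\<Sum>c\<in>proper_edge_colorings q E. \<Sum>y\<in>free_colors q E l c x. ?g (c, y))"
      using insert.hyps by (subst sum.Sigma) (auto intro!: finite_proper_edge_colorings)
    \<comment> \<open>The inner sum has as many equal terms as \<open>x\<close> has free colors, so
      it is \<open>?w c\<close>, or 0 if no color is free.\<close>
    also have "\<dots> \<le> (\<Sum>c\<in>proper_edge_colorings q E. ?w c)"
      by (intro sum_mono) (auto intro!: prod_nonneg)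
    also note insert.IH
    finally show ?thesis .
  qed
qed

text \<open>Jensen's inequality for \<open>ln\<close>, from the tangent bound ln y \<le> y - 1 at y
  = \<open>f x / m\<close>. As \<open>m\<close> is the mean, the linear corrections sum to
  0.\<close>

lemma sum_ln_le_card_ln_mean:
  fixes f :: "'a \<Rightarrow> real"
  assumes "finite A" "A \<noteq> {}" and pos: "\<And>x. x \<in> A \<Longrightarrow> f x > 0"
  shows "(\<Sum>x\<in>A. ln (f x)) \<le> real (card A) * ln (sum f A / real (card A))"
proof -
  define m where "m = sum f A / real (card A)"
  have card: "real (card A) > 0" using assms by (simp add: card_gt_0_iff)
  have "sum f A > 0" using assms by (intro sum_pos) auto
  then have m: "m > 0" using card by (simp add: m_def)
  have "(\<Sum>x\<in>A. ln (f x)) \<le> (\<Sum>x\<in>A. ln m + (f x / m - 1))"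
  proof (rule sum_mono)
    fix x assume "x \<in> A"
    then have "ln (f x / m) \<le> f x / m - 1" using pos m by (intro ln_le_minus_one) auto
    then show "ln (f x) \<le> ln m + (f x / m - 1)" using pos[OF \<open>x \<in> A\<close>] m by (simp add: ln_div)
  qed
  also have "\<dots> = real (card A) * ln m + (sum f A / m - real (card A))"
    by (simp add: sum.distrib sum_subtractf sum_divide_distrib)
  also have "sum f A / m = real (card A)" using card \<open>sum f A > 0\<close> by (simp add: m_def)
  finally show ?thesis by (simp add: m_def)
qed

text \<open>Jensen is applied to the greedy weights \<open>?w c\<close>. Their mean over
  \<open>S\<close> is at most \<open>1 / card S\<close>, and the logarithm of each is minus the
  inner sum on the right.\<close>

lemma ln_card_proper_edge_colorings_le:
  fixes l :: "'a set \<Rightarrow> 'b::linorder" and q :: nat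
  assumes "finite E"
  defines "S \<equiv> proper_edge_colorings q E"
  shows "real (card S) * ln (real (card S)) \<le> (\<Sum>c\<in>S. \<Sum>e\<in>E. ln (real (card (free_colors q E l c e))))"
proof (cases "S = {}")
  case False
  let ?w = "\<lambda>c. \<Prod>e\<in>E. 1 / real (card (free_colors q E l c e))"
  have fin: "finite S" unfolding S_def by (rule finite_proper_edge_colorings) fact
  have w: "?w c > 0" if "c \<in> S" for c
    using that card_free_colors_pos[of c q E _ l] by (intro prod_pos) (auto simp: S_def)
  have card: "real (card S) > 0" using fin False by (simp add: card_gt_0_iff)
  have "- (\<Sum>c\<in>S. \<Sum>e\<in>E. ln (real (card (free_colors q E l c e)))) = (\<Sum>c\<in>S. ln (?w c))"
    unfolding sum_negf[symmetric]
  proof (intro sum.cong refl)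
    fix c assume "c \<in> S"
    then show "(\<Sum>e\<in>E. - ln (real (card (free_colors q E l c e)))) = ln (?w c)"
      using card_free_colors_pos[of c q E _ l] assms
      by (subst ln_prod) (fastforce simp: ln_div card_gt_0_iff intro!: sum.cong)+
  qed
  also have "\<dots> \<le> real (card S) * ln (sum ?w S / real (card S))"
    by (rule sum_ln_le_card_ln_mean[OF fin False w])
  also have "\<dots> \<le> real (card S) * ln (1 / real (card S))"
  proof -
    have "sum ?w S > 0" using fin False w by (intro sum_pos) auto
    moreover have "sum ?w S \<le> 1"
      unfolding S_def by (rule sum_prod_inverse_free_colors_le_1) fact
    ultimately show ?thesis using card by (intro mult_left_mono ln_mono divide_right_mono) auto
  qed
  also have "\<dots> = - (real (card S) * ln (real (card S)))" using card by (simp add: ln_div)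
  finally show ?thesis by linarith
qed simp


section \<open>Counting labelings in which given edges do not precede \<open>e\<close>\<close>

text \<open>The labelings form a box: the coordinate \<open>e\<close> is fixed, those in
  \<open>A\<close> range over \<open>{t..<M}\<close>, and all others are unrestricted. This is
  independence of the labels in counting form.\<close>

lemma card_labelings:
  fixes M t :: nat
  assumes "finite E" "e \<in> E" "A \<subseteq> E - {e}" and t: "t < M"
  shows "card {l \<in> E \<rightarrow>\<^sub>E {..<M}. l e = t \<and> (\<forall>f\<in>A. t \<le> l f)} =
           (M - t) ^ card A * M ^ (card E - 1 - card A)"
proof -
  let ?B = "\<lambda>f. if f = e then {t} else if f \<in> A then {t..<M} else {..<M}"
  have fin: "finite A" using assms finite_subset by blast
  have "{l \<in> E \<rightarrow>\<^sub>E {..<M}. l e = t \<and> (\<forall>f\<in>A. t \<le> l f)} = PiE E ?B"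
  proof (intro equalityI subsetI)
    fix l assume "l \<in> PiE E ?B"
    then have l: "l \<in> extensional E" "l f \<in> ?B f" if "f \<in> E" for f
      using that by (auto simp: PiE_iff)
    have "l f < M" if "f \<in> E" for f using l(2)[OF that] t by (auto split: if_splits)
    moreover have "l e = t" using l(2)[of e] assms by simp
    moreover have "t \<le> l f" if "f \<in> A" for f
    proof -
      have "f \<in> E" "f \<noteq> e" using that assms(3) by auto
      with l(2)[of f] that show ?thesis by simp
    qed
    ultimately show "l \<in> {l \<in> E \<rightarrow>\<^sub>E {..<M}. l e = t \<and> (\<forall>f\<in>A. t \<le> l f)}"
      using l(1) assms(2) by (auto simp: PiE_iff)
  qed (use t assms(3) in \<open>auto simp: PiE_iff\<close>)
  then have "card {l \<in> E \<rightarrow>\<^sub>E {..<M}. l e = t \<and> (\<forall>f\<in>A. t \<le> l f)} = (\<Prod>f\<in>E. card (?B f))"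
    using assms(1) by (simp add: card_PiE)
  also have "\<dots> = (\<Prod>f\<in>E - {e}. card (?B f))"
    using assms by (simp add: prod.remove)
  also have "\<dots> = (\<Prod>f\<in>E - {e} - A. card (?B f)) * (\<Prod>f\<in>A. card (?B f))"
    using assms by (intro prod.subset_diff) auto
  also have "(\<Prod>f\<in>E - {e} - A. card (?B f)) = (\<Prod>f\<in>E - {e} - A. M)"
    by (intro prod.cong) auto
  also have "\<dots> = M ^ (card E - 1 - card A)"
    using assms fin by (simp add: card_Diff_subset)
  also have "(\<Prod>f\<in>A. card (?B f)) = (\<Prod>f\<in>A. M - t)"
    using assms(3) by (intro prod.cong) auto
  finally show ?thesis by (simp add: mult.commute)
qed

text \<open>Each edge of \<open>A\<close> contributes a factor \<open>(M - t) / M\<close>, which is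
  at most 1, so keeping \<open>k\<close> of these factors gives an upper bound.\<close>

lemma card_labelings_le:
  fixes M t k :: nat
  assumes "finite E" "e \<in> E" "A \<subseteq> E - {e}" "t < M" "k \<le> card A"
  shows "real (card {l \<in> E \<rightarrow>\<^sub>E {..<M}. l e = t \<and> (\<forall>f\<in>A. t \<le> l f)}) \<le>
           real M ^ (card E - 1) * (real (M - t) / real M) ^ k"
proof -
  have "card A \<le> card (E - {e})" using assms by (intro card_mono) auto
  then have A: "card A \<le> card E - 1" using assms by simp
  have "real M ^ (card E - 1) = real M ^ (card E - 1 - card A) * real M ^ card A"
    using A by (metis le_add_diff_inverse2 power_add)
  then have "real (card {l \<in> E \<rightarrow>\<^sub>E {..<M}. l e = t \<and> (\<forall>f\<in>A. t \<le> l f)}) =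
      real M ^ (card E - 1) * (real (M - t) / real M) ^ card A"
    using assms card_labelings[OF assms(1-4)] by (simp add: power_divide)
  also have "\<dots> \<le> real M ^ (card E - 1) * (real (M - t) / real M) ^ k"
    using assms by (intro mult_left_mono power_decreasing) auto
  finally show ?thesis .
qed

section \<open>Few colors fail to meet an edge in \<open>k\<close> distinct edges\<close>

lemma codegree_le_max_codegree:
  assumes "finite V" "u \<in> V" "v \<in> V" "u \<noteq> v"
  shows "codegree E u v \<le> max_codegree V E"
  unfolding max_codegree_def
proof (rule Max_ge)
  have "{codegree E u v |u v. u \<in> V \<and> v \<in> V \<and> u \<noteq> v} \<subseteq> (\<lambda>(u, v). codegree E u v) ` (V \<times> V)"
    by auto
  then show "finite (insert 0 {codegree E u v |u v. u \<in> V \<and> v \<in> V \<and> u \<noteq> v})"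
    using assms(1) finite_subset by blast
qed (use assms in blast)

text \<open>A bad color either is missing at some vertex of \<open>e\<close> or sits on an edge
  containing two vertices of \<open>e\<close>. Each vertex sees \<open>D\<close> distinct colors and
  so misses \<open>q - D\<close>; each of the at most \<open>k * k\<close> ordered pairs accounts
  for at most the maximum codegree.\<close>

lemma card_bad_colors_le:
  assumes hyp: "hypergraph V E" "uniform_hypergraph k E" "regular_hypergraph D V E"
    and c: "c \<in> proper_edge_colorings q E" and e: "e \<in> E"
  shows "card {x \<in> {1..q}. x \<noteq> c e \<and> card {f \<in> E. f \<noteq> e \<and> f \<inter> e \<noteq> {} \<and> c f = x} < k}
           \<le> k * (q - D) + k * k * max_codegree V E"
    (is "card ?bad \<le> _")
proof -
  have V: "finite V" "E \<subseteq> Pow V" using hyp(1) by (auto simp: hypergraph_def)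
  have finE: "finite E" by (rule finite_edges[OF hyp(1)])
  have eV: "e \<subseteq> V" using V e by auto
  have fine: "finite e" using eV V finite_subset by blast
  have cde: "card e = k" using hyp(2) e by (simp add: uniform_hypergraph_def)
  define Miss where "Miss v = {1..q} - c ` {f \<in> E. v \<in> f}" for v
  define Dbl where "Dbl p = c ` {f \<in> E. fst p \<in> f \<and> snd p \<in> f}" for p
  let ?P = "{p \<in> e \<times> e. fst p \<noteq> snd p}"
  have finP: "finite ?P" using fine by auto
  have "?bad \<subseteq> (\<Union>v\<in>e. Miss v) \<union> (\<Union>p\<in>?P. Dbl p)"
  proof
    fix x assume x: "x \<in> ?bad"
    show "x \<in> (\<Union>v\<in>e. Miss v) \<union> (\<Union>p\<in>?P. Dbl p)"
    proof (rule ccontr)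
      assume neg: "x \<notin> (\<Union>v\<in>e. Miss v) \<union> (\<Union>p\<in>?P. Dbl p)"
      have "\<forall>v\<in>e. \<exists>f\<in>E. v \<in> f \<and> c f = x" using neg x by (auto simp: Miss_def)
      then obtain g where g: "\<And>v. v \<in> e \<Longrightarrow> g v \<in> E \<and> v \<in> g v \<and> c (g v) = x" by metis
      have inj: "inj_on g e"
      proof (rule inj_onI, rule ccontr)
        fix u v assume "u \<in> e" "v \<in> e" "g u = g v" "u \<noteq> v"
        moreover from this have "x \<in> Dbl (u, v)" using g[of u] g[of v] by (auto simp: Dbl_def)
        ultimately show False using neg by auto
      qed
      \<comment> \<open>No \<open>g v\<close> is \<open>e\<close> itself, because \<open>x\<close>
        differs from \<open>c e\<close>.\<close>
      have "g ` e \<subseteq> {f \<in> E. f \<noteq> e \<and> f \<inter> e \<noteq> {} \<and> c f = x}" using g x by fastforce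
      then have "card e \<le> card {f \<in> E. f \<noteq> e \<and> f \<inter> e \<noteq> {} \<and> c f = x}"
        using inj finE by (intro card_inj_on_le[of g]) auto
      then show False using x cde by simp
    qed
  qed
  then have "card ?bad \<le> card ((\<Union>v\<in>e. Miss v) \<union> (\<Union>p\<in>?P. Dbl p))"
    using fine finE finP by (intro card_mono) (auto simp: Miss_def Dbl_def)
  also have "\<dots> \<le> card (\<Union>v\<in>e. Miss v) + card (\<Union>p\<in>?P. Dbl p)" by (rule card_Un_le)
  also have "card (\<Union>v\<in>e. Miss v) \<le> (\<Sum>v\<in>e. card (Miss v))" by (rule card_UN_le[OF fine])
  also have "\<dots> = (\<Sum>v\<in>e. q - D)"
  proof (rule sum.cong[OF refl])
    fix v assume v: "v \<in> e"
    have "inj_on c {f \<in> E. v \<in> f}"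
      using c by (fastforce simp: proper_edge_colorings_def inj_on_def)
    then have "card (c ` {f \<in> E. v \<in> f}) = D"
      using hyp(3) v eV by (auto simp: card_image regular_hypergraph_def vertex_degree_def)
    moreover have "c ` {f \<in> E. v \<in> f} \<subseteq> {1..q}"
      using c by (auto simp: proper_edge_colorings_def PiE_iff)
    ultimately show "card (Miss v) = q - D"
      using finE by (simp add: Miss_def card_Diff_subset)
  qed
  also have "\<dots> = k * (q - D)" using cde by simp
  also have "card (\<Union>p\<in>?P. Dbl p) \<le> (\<Sum>p\<in>?P. card (Dbl p))" by (rule card_UN_le[OF finP])
  also have "\<dots> \<le> (\<Sum>p\<in>?P. max_codegree V E)"
  proof (rule sum_mono)
    fix p assume p: "p \<in> ?P"
    have "card (Dbl p) \<le> codegree E (fst p) (snd p)"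
      unfolding Dbl_def codegree_def using finE by (intro card_image_le) auto
    also have "\<dots> \<le> max_codegree V E"
      using p eV V by (intro codegree_le_max_codegree) auto
    finally show "card (Dbl p) \<le> max_codegree V E" .
  qed
  also have "\<dots> = card ?P * max_codegree V E" by simp
  also have "card ?P \<le> card (e \<times> e)" using fine by (intro card_mono) auto
  also have "card (e \<times> e) = k * k" using cde by (simp add: card_cartesian_product)
  finally show ?thesis by simp
qed

section \<open>Averaging over random labels\<close>

text \<open>Labelings are grouped by the label \<open>t\<close> of \<open>e\<close>, and Jensen is
  applied in each group. In the mean number of free colors, the 1 stands for the color
  \<open>c e\<close>, the next term bounds the bad colors, and every other color survives in at most
  a fraction \<open>((M - t) / M) ^ k\<close> of the group.\<close>

lemma sum_ln_free_colors_le: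
  fixes M :: nat
  assumes hyp: "hypergraph V E" "uniform_hypergraph k E" "regular_hypergraph D V E"
    and c: "c \<in> proper_edge_colorings q E" and e: "e \<in> E"
  shows "(\<Sum>l\<in>E \<rightarrow>\<^sub>E {..<M}. ln (real (card (free_colors q E l c e)))) \<le>
      real M ^ (card E - 1) * (\<Sum>t<M. ln (1 + real (k * (q - D) + k * k * max_codegree V E)
        + real q * (real (M - t) / real M) ^ k))"
    (is "_ \<le> _ * (\<Sum>t<M. ln (1 + real ?B + _ t))")
proof -
  have finE: "finite E" by (rule finite_edges[OF hyp(1)])
  define L where "L t = {l \<in> E \<rightarrow>\<^sub>E {..<M}. l e = t}" for t
  define N where "N l = card (free_colors q E l c e)" for l :: "'a set \<Rightarrow> nat"
  define F where "F x = {f \<in> E. f \<noteq> e \<and> f \<inter> e \<noteq> {} \<and> c f = x}" for x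
  define bad where "bad = {x \<in> {1..q}. x \<noteq> c e \<and> card (F x) < k}"
  have finL: "finite (L t)" for t
    unfolding L_def using finE by (intro finite_subset[OF _ finite_PiE[of E "\<lambda>_. {..<M}"]]) auto
  have step: "(\<Sum>l\<in>L t. ln (real (N l))) \<le>
      real M ^ (card E - 1) * ln (1 + real ?B + real q * (real (M - t) / real M) ^ k)"
    if t: "t < M" for t
  proof -
    let ?r = "(real (M - t) / real M) ^ k"
    have cardL: "card (L t) = M ^ (card E - 1)"
      using card_labelings[OF finE e _ t, of "{}"] by (simp add: L_def)
    have M: "real M ^ (card E - 1) > 0" using t by simp
    have "L t \<noteq> {}" using cardL t by (metis card.empty not_less_zero power_eq_0_iff)
    have Npos: "real (N l) > 0" for l
      unfolding N_def using card_free_colors_pos[OF c e, of l] by simp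
    \<comment> \<open>Double counting of pairs of a labeling and a color free under it:
      \<open>x\<close> is free exactly when no edge of \<open>F x\<close> has a label below
      \<open>t\<close>.\<close>
    have "(\<Sum>l\<in>L t. N l) = (\<Sum>l\<in>L t. \<Sum>x\<in>{1..q}. if \<forall>f\<in>F x. t \<le> l f then 1 else 0)"
    proof (rule sum.cong[OF refl])
      fix l assume "l \<in> L t"
      then have "free_colors q E l c e = {x \<in> {1..q}. \<forall>f\<in>F x. t \<le> l f}"
        by (auto simp: free_colors_def F_def L_def)
      then show "N l = (\<Sum>x\<in>{1..q}. if \<forall>f\<in>F x. t \<le> l f then 1 else 0)"
        by (simp only: N_def card_eq_sum sum.inter_filter[OF finite_atLeastAtMost])
    qed
    also have "\<dots> = (\<Sum>x\<in>{1..q}. \<Sum>l\<in>L t. if \<forall>f\<in>F x. t \<le> l f then 1 else 0)"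
      by (rule sum.swap)
    also have "\<dots> = (\<Sum>x\<in>{1..q}. card {l \<in> L t. \<forall>f\<in>F x. t \<le> l f})"
      by (simp only: card_eq_sum sum.inter_filter[OF finL])
    finally have "(\<Sum>l\<in>L t. real (N l)) = (\<Sum>x\<in>{1..q}. real (card {l \<in> L t. \<forall>f\<in>F x. t \<le> l f}))"
      unfolding of_nat_sum[symmetric] by (simp only:)
    also have "\<dots> \<le> (\<Sum>x\<in>{1..q}. real M ^ (card E - 1) *
        ((if x = c e then 1 else 0) + (if x \<in> bad then 1 else 0) + ?r))"
    proof (rule sum_mono)
      fix x assume x: "x \<in> {1..q}"
      show "real (card {l \<in> L t. \<forall>f\<in>F x. t \<le> l f}) \<le> real M ^ (card E - 1) *
        ((if x = c e then 1 else 0) + (if x \<in> bad then 1 else 0) + ?r)"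
      proof (cases "x = c e \<or> x \<in> bad")
        case True
        have "card {l \<in> L t. \<forall>f\<in>F x. t \<le> l f} \<le> card (L t)"
          using finL by (intro card_mono) auto
        then have "real (card {l \<in> L t. \<forall>f\<in>F x. t \<le> l f}) \<le> real (card (L t))"
          by (simp only: of_nat_le_iff)
        also have "\<dots> = real M ^ (card E - 1) * 1" by (simp add: cardL)
        also have "\<dots> \<le> real M ^ (card E - 1) *
            ((if x = c e then 1 else 0) + (if x \<in> bad then 1 else 0) + ?r)"
          using True by (intro mult_left_mono) auto
        finally show ?thesis .
      next
        case False
        then have "k \<le> card (F x)" using x by (auto simp: bad_def)
        then show ?thesis
          using False card_labelings_le[OF finE e _ t, of "F x" k]
          by (auto simp: L_def F_def conj_assoc)
      qed
    qed
    also have "\<dots> = real M ^ (card E - 1) * (real (card ({1..q} \<inter> {c e})) + real (card ({1..q} \<inter> bad)) + real q * ?r)"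
      by (simp add: sum.distrib sum.If_cases flip: sum_distrib_left)
    also have "\<dots> \<le> real M ^ (card E - 1) * (1 + real ?B + real q * ?r)"
    proof -
      have "card ({1..q} \<inter> {c e}) \<le> 1"
        by (rule order_trans[OF card_mono[of "{c e}"]]) auto
      moreover have "card ({1..q} \<inter> bad) \<le> ?B"
      proof -
        have "{1..q} \<inter> bad = bad" by (auto simp: bad_def)
        then show ?thesis using card_bad_colors_le[OF hyp c e] by (simp only: bad_def F_def)
      qed
      ultimately have "real (card ({1..q} \<inter> {c e})) + real (card ({1..q} \<inter> bad)) \<le> 1 + real ?B"
        by linarith
      then show ?thesis by (intro mult_left_mono) auto
    qed
    finally have mean: "(\<Sum>l\<in>L t. real (N l)) / real (card (L t)) \<le> 1 + real ?B + real q * ?r"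
      using M cardL by (simp add: field_simps)
    have "(\<Sum>l\<in>L t. real (N l)) > 0"
      using finL \<open>L t \<noteq> {}\<close> Npos by (intro sum_pos) auto
    then have mpos: "(\<Sum>l\<in>L t. real (N l)) / real (card (L t)) > 0"
      using M cardL by simp
    have "(\<Sum>l\<in>L t. ln (real (N l))) \<le>
        real (card (L t)) * ln ((\<Sum>l\<in>L t. real (N l)) / real (card (L t)))"
      by (rule sum_ln_le_card_ln_mean[OF finL \<open>L t \<noteq> {}\<close> Npos])
    also have "\<dots> \<le> real (card (L t)) * ln (1 + real ?B + real q * ?r)"
      using mean mpos by (intro mult_left_mono ln_mono) auto
    finally show ?thesis by (simp add: cardL)
  qed
  have "(\<Sum>l\<in>E \<rightarrow>\<^sub>E {..<M}. ln (real (N l))) = (\<Sum>t<M. \<Sum>l\<in>L t. ln (real (N l)))"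
    unfolding L_def using finE e
    by (intro sum.group[symmetric]) (auto intro!: finite_PiE simp: PiE_iff)
  also have "\<dots> \<le> (\<Sum>t<M. real M ^ (card E - 1) *
      ln (1 + real ?B + real q * (real (M - t) / real M) ^ k))"
    using step by (intro sum_mono) auto
  finally show ?thesis by (simp add: N_def sum_distrib_left)
qed

text \<open>The entropy inequality is summed over all labelings, on which its left side does not
  depend. Once the sum over labelings is innermost, the preceding estimate applies uniformly in
  \<open>c\<close> and \<open>e\<close>.\<close>

lemma ln_card_proper_edge_colorings_bound:
  fixes M :: nat
  assumes hyp: "hypergraph V E" "uniform_hypergraph k E" "regular_hypergraph D V E"
    and ne: "proper_edge_colorings q E \<noteq> {}" and M: "M > 0"
  shows "real M * ln (real (card (proper_edge_colorings q E))) \<le>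
      real (card E) * (\<Sum>t<M. ln (1 + real (k * (q - D) + k * k * max_codegree V E)
        + real q * (real (M - t) / real M) ^ k))"
    (is "_ \<le> _ * ?G")
proof (cases "E = {}")
  case True
  then show ?thesis by (simp add: proper_edge_colorings_def)
next
  case False
  have finE: "finite E" by (rule finite_edges[OF hyp(1)])
  let ?S = "proper_edge_colorings q E" and ?L = "E \<rightarrow>\<^sub>E {..<M}"
  have finS: "finite ?S" by (rule finite_proper_edge_colorings[OF finE])
  \<comment> \<open>Splitting off one factor needs \<open>E\<close> nonempty, as
    \<open>card E - 1\<close> is truncated subtraction.\<close>
  have pow: "real M ^ card E = real M * real M ^ (card E - 1)"
    using False finE by (metis card_gt_0_iff power_eq_if not_less_zero)
  have "real M ^ card E * (real (card ?S) * ln (real (card ?S)))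
      = (\<Sum>l\<in>?L. real (card ?S) * ln (real (card ?S)))"
    using finE by (simp add: card_PiE)
  also have "\<dots> \<le> (\<Sum>l\<in>?L. \<Sum>c\<in>?S. \<Sum>e\<in>E. ln (real (card (free_colors q E l c e))))"
    by (intro sum_mono ln_card_proper_edge_colorings_le finE)
  also have "\<dots> = (\<Sum>c\<in>?S. \<Sum>l\<in>?L. \<Sum>e\<in>E. ln (real (card (free_colors q E l c e))))"
    by (rule sum.swap)
  also have "\<dots> = (\<Sum>c\<in>?S. \<Sum>e\<in>E. \<Sum>l\<in>?L. ln (real (card (free_colors q E l c e))))"
    by (intro sum.cong refl sum.swap)
  also have "\<dots> \<le> (\<Sum>c\<in>?S. \<Sum>e\<in>E. real M ^ (card E - 1) * ?G)"
    by (intro sum_mono sum_ln_free_colors_le[OF hyp])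
  finally have "(real M ^ (card E - 1) * real (card ?S)) * (real M * ln (real (card ?S)))
      \<le> (real M ^ (card E - 1) * real (card ?S)) * (real (card E) * ?G)"
    by (simp add: pow mult_ac)
  moreover have "real M ^ (card E - 1) * real (card ?S) > 0"
    using M ne finS by (simp add: card_gt_0_iff)
  ultimately show ?thesis by (meson mult_le_cancel_left_pos)
qed

section \<open>A Stirling bound and the origin of the factor \<open>exp (- k)\<close>\<close>

text \<open>A weak Stirling bound, n! \<le> e n (n/e)^n. The induction step reduces to 1 \<le> (n+1)
  (ln (n+1) - ln n), which again follows from ln y \<le> y - 1.\<close>

lemma ln_fact_le:
  assumes "n > 0"
  shows "ln (fact n :: real) \<le> (real n + 1) * ln (real n) - real n + 1"
  using assms
proof (induction n rule: nat_induct_non_zero)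
  case (Suc n)
  have "ln (real n / real (Suc n)) \<le> real n / real (Suc n) - 1"
    using Suc.hyps by (intro ln_le_minus_one) auto
  also have "\<dots> = - 1 / real (Suc n)" by (simp add: field_simps)
  finally have "1 / real (Suc n) \<le> ln (real (Suc n)) - ln (real n)"
    using Suc.hyps by (simp add: ln_div)
  then have *: "1 \<le> (real n + 1) * (ln (real (Suc n)) - ln (real n))"
    by (simp add: field_simps)
  have "ln (fact (Suc n) :: real) = ln (real (Suc n)) + ln (fact n)"
    by (simp add: ln_mult del: of_nat_Suc)
  with Suc.IH * show ?case by (simp add: algebra_simps)
qed simp

text \<open>The numbers \<open>M - t\<close> multiply to M!. Divided by \<open>M\<close>, the sum is
  a Riemann sum for the integral of k ln (1 - s) over [0,1], which equals -k.\<close>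

lemma sum_ln_power_le:
  fixes M k :: nat
  assumes M: "M > 0"
  shows "(\<Sum>t<M. ln ((real (M - t) / real M) ^ k)) \<le> real k * (ln (real M) + 1 - real M)"
proof -
  have "(\<Sum>t<M. ln ((real (M - t) / real M) ^ k)) =
      (\<Sum>t<M. real k * (ln (real (M - t)) - ln (real M)))"
    using M by (intro sum.cong refl) (simp add: ln_realpow ln_div)
  also have "\<dots> = real k * ((\<Sum>t<M. ln (real (M - t))) - real M * ln (real M))"
    by (simp add: sum_subtractf flip: sum_distrib_left)
  also have "(\<Sum>t<M. ln (real (M - t))) = ln (\<Prod>t<M. real (M - t))"
    by (subst ln_prod) auto
  also have "(\<Prod>t<M. real (M - t)) = fact M"
    by (simp add: fact_prod_rev[of M] atLeast0LessThan)
  also have "real k * (ln (fact M) - real M * ln (real M)) \<le> real k * (ln (real M) + 1 - real M)"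
    using ln_fact_le[OF M] by (intro mult_left_mono) (auto simp: algebra_simps)
  finally show ?thesis .
qed

section \<open>Passage to the limit\<close>

text \<open>Double counting of incidences; it identifies the exponent Dn/k with the number of
  edges.\<close>

lemma card_edges_regular_uniform:
  assumes "hypergraph V E" "uniform_hypergraph k E" "regular_hypergraph D V E"
  shows "k * card E = D * card V"
proof -
  have V: "finite V" "E \<subseteq> Pow V" using assms(1) by (auto simp: hypergraph_def)
  have "(\<Sum>v\<in>V. card {e \<in> E. v \<in> e}) = k * card E"
  proof (rule sum_multicount[OF V(1) finite_edges[OF assms(1)]])
    show "\<forall>e\<in>E. card {v \<in> V. v \<in> e} = k"
    proof
      fix e assume "e \<in> E"
      then have "{v \<in> V. v \<in> e} = e" using V(2) by auto
      with \<open>e \<in> E\<close> show "card {v \<in> V. v \<in> e} = k"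
        using assms(2) by (simp add: uniform_hypergraph_def)
    qed
  qed
  moreover have "(\<Sum>v\<in>V. card {e \<in> E. v \<in> e}) = (\<Sum>v\<in>V. D)"
    using assms(3) by (intro sum.cong) (auto simp: regular_hypergraph_def vertex_degree_def)
  ultimately show ?thesis by (simp add: mult.commute)
qed

text \<open>The bound with a fixed error factor. The number \<open>M\<close> of labels is chosen
  from \<open>k\<close> and \<epsilon> alone; then the relative error \<delta> from own and bad
  colors tends to 0 along \<open>F\<close>.\<close>

lemma eventually_card_proper_edge_colorings_le:
  fixes k :: nat
    and F :: "'i filter"
    and V :: "'i \<Rightarrow> 'a set" and E :: "'i \<Rightarrow> 'a set set"
    and D q :: "'i \<Rightarrow> nat"
  assumes hyp: "\<And>i. hypergraph (V i) (E i)" "\<And>i. uniform_hypergraph k (E i)"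
      "\<And>i. regular_hypergraph (D i) (V i) (E i)"
    and q_top: "filterlim (\<lambda>i. real (q i)) at_top F"
    and qD: "(\<lambda>i. real (q i)) \<sim>[F] (\<lambda>i. real (D i))"
    and codeg: "(\<lambda>i. real (max_codegree (V i) (E i))) \<in> o[F](\<lambda>i. real (q i))"
    and \<epsilon>: "\<epsilon> > 0"
  shows "\<forall>\<^sub>F i in F. real (card (proper_edge_colorings (q i) (E i)))
           \<le> (exp \<epsilon> * (real (q i) / exp (real k))) powr real (card (E i))"
proof -
  define B where "B i = real (k * (q i - D i) + k * k * max_codegree (V i) (E i))" for i
  define \<delta> where "\<delta> i = (1 + B i) / real (q i)" for i
  have q_pos: "\<forall>\<^sub>F i in F. real (q i) > 0"
    using q_top by (rule filterlim_at_top_dense[THEN iffD1, rule_format])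
  have inv: "((\<lambda>i. 1 / real (q i)) \<longlongrightarrow> 0) F"
    using tendsto_inverse_0_at_top[OF q_top] by (simp add: inverse_eq_divide)
  have Dq: "((\<lambda>i. real (D i) / real (q i)) \<longlongrightarrow> 1) F"
  \<comment> \<open>The definition of asymptotic equivalence reads 0/0 as 1; this case eventually
    disappears because \<open>q i\<close> is positive.\<close>
  proof (rule Lim_transform_eventually)
    show "((\<lambda>i. if real (D i) = 0 \<and> real (q i) = 0 then 1 else real (D i) / real (q i)) \<longlongrightarrow> 1) F"
      using asymp_equiv_symI[OF qD] by (simp add: asymp_equiv_def)
    show "\<forall>\<^sub>F i in F. (if real (D i) = 0 \<and> real (q i) = 0 then 1 else real (D i) / real (q i))
            = real (D i) / real (q i)"
      using q_pos by eventually_elim auto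
  qed
  \<comment> \<open>The \<open>max 0\<close> mirrors the truncated subtraction
    \<open>q i - D i\<close>, since \<open>D i\<close> may exceed \<open>q i\<close>.\<close>
  have "((\<lambda>i. 1 / real (q i) + real k * max 0 (1 - real (D i) / real (q i))
      + real k * real k * (real (max_codegree (V i) (E i)) / real (q i))) \<longlongrightarrow>
      0 + real k * max 0 (1 - 1) + real k * real k * 0) F"
    by (intro tendsto_intros inv Dq smalloD_tendsto[OF codeg])
  moreover have "\<forall>\<^sub>F i in F. 1 / real (q i) + real k * max 0 (1 - real (D i) / real (q i))
      + real k * real k * (real (max_codegree (V i) (E i)) / real (q i)) = \<delta> i"
    using q_pos
  proof eventually_elim
    case (elim i)
    have "real (q i - D i) = real (q i) * max 0 (1 - real (D i) / real (q i))"
      using elim by (auto simp: max_def field_simps of_nat_diff)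
    then show ?case using elim by (simp add: \<delta>_def B_def field_simps)
  qed
  ultimately have \<delta>: "(\<delta> \<longlongrightarrow> 0) F" by (simp add: Lim_transform_eventually)
  \<comment> \<open>This is the error \<open>k * (ln M + 1)\<close> of
    \<open>sum_ln_power_le\<close> divided by \<open>M\<close>; it must drop below
    \<epsilon>.\<close>
  have "((\<lambda>n. real k * (ln (real n) / real n + 1 / real n)) \<longlongrightarrow> real k * (0 + 0)) sequentially"
    by (intro tendsto_intros lim_1_over_n
        filterlim_compose[OF ln_x_over_x_tendsto_0 filterlim_real_sequentially])
  then have "\<forall>\<^sub>F n in sequentially. real k * (ln (real n) / real n + 1 / real n) < \<epsilon>"
    using \<epsilon> by (intro order_tendstoD) auto
  then have "\<forall>\<^sub>F n in sequentially. n > 0 \<and> real k * (ln (real n) / real n + 1 / real n) < \<epsilon>"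
    using eventually_gt_at_top[of 0] by eventually_elim auto
  then obtain M :: nat where M: "M > 0" "real k * (ln (real M) / real M + 1 / real M) < \<epsilon>"
    by (metis (no_types, lifting) eventually_happens' sequentially_bot)
  have "real k * (ln (real M) + 1 - real M) < real M * (\<epsilon> - real k)"
    using M by (simp add: field_simps)
  then have lim_less: "(\<Sum>t<M. ln (0 + (real (M - t) / real M) ^ k)) < real M * (\<epsilon> - real k)"
    using sum_ln_power_le[OF M(1), of k] by simp
  \<comment> \<open>The sum is finite and, as \<open>t < M\<close>, each argument of
    \<open>ln\<close> has a positive limit, so \<open>ln\<close> is continuous there.\<close>
  have "((\<lambda>i. \<Sum>t<M. ln (\<delta> i + (real (M - t) / real M) ^ k)) \<longlongrightarrow>
      (\<Sum>t<M. ln (0 + (real (M - t) / real M) ^ k))) F"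
    using M(1) by (intro tendsto_sum tendsto_ln tendsto_add \<delta> tendsto_const) auto
  then have "\<forall>\<^sub>F i in F. (\<Sum>t<M. ln (\<delta> i + (real (M - t) / real M) ^ k)) < real M * (\<epsilon> - real k)"
    using lim_less by (rule order_tendstoD)
  with q_pos show ?thesis
  proof eventually_elim
    case (elim i)
    let ?S = "proper_edge_colorings (q i) (E i)"
    show ?case
    proof (cases "?S = {}")
      case False
      have "finite ?S" by (intro finite_proper_edge_colorings finite_edges[OF hyp(1)])
      then have card: "real (card ?S) > 0" using False by (simp add: card_gt_0_iff)
      have \<delta>0: "\<delta> i \<ge> 0" by (simp add: \<delta>_def B_def)
      have "real M * ln (real (card ?S)) \<le> real (card (E i)) *
          (\<Sum>t<M. ln (1 + B i + real (q i) * (real (M - t) / real M) ^ k))"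
        unfolding B_def by (rule ln_card_proper_edge_colorings_bound[OF hyp False M(1)])
      also have "(\<Sum>t<M. ln (1 + B i + real (q i) * (real (M - t) / real M) ^ k)) =
          (\<Sum>t<M. ln (real (q i)) + ln (\<delta> i + (real (M - t) / real M) ^ k))"
      proof (intro sum.cong refl)
        fix t assume "t \<in> {..<M}"
        then have "\<delta> i + (real (M - t) / real M) ^ k > 0" using \<delta>0 by (intro add_nonneg_pos) auto
        moreover have "1 + B i + real (q i) * (real (M - t) / real M) ^ k =
            real (q i) * (\<delta> i + (real (M - t) / real M) ^ k)"
          using elim(1) by (simp add: \<delta>_def field_simps)
        ultimately show "ln (1 + B i + real (q i) * (real (M - t) / real M) ^ k) =
            ln (real (q i)) + ln (\<delta> i + (real (M - t) / real M) ^ k)"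
          using elim(1) by (simp add: ln_mult)
      qed
      also have "\<dots> = real M * ln (real (q i)) + (\<Sum>t<M. ln (\<delta> i + (real (M - t) / real M) ^ k))"
        by (simp add: sum.distrib)
      also have "real (card (E i)) * \<dots> \<le>
          real (card (E i)) * (real M * ln (real (q i)) + real M * (\<epsilon> - real k))"
        using elim(2) by (intro mult_left_mono) auto
      also have "\<dots> = real M * (real (card (E i)) * (ln (real (q i)) + \<epsilon> - real k))"
        by (simp add: algebra_simps)
      finally have "ln (real (card ?S)) \<le> real (card (E i)) * (ln (real (q i)) + \<epsilon> - real k)"
        using M(1) by (simp add: mult_le_cancel_left_pos)
      also have "ln (real (q i)) + \<epsilon> - real k = ln (exp \<epsilon> * (real (q i) / exp (real k)))"
        using elim(1) by (simp add: ln_mult ln_div)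
      finally have "exp (ln (real (card ?S))) \<le>
          exp (real (card (E i)) * ln (exp \<epsilon> * (real (q i) / exp (real k))))"
        by simp
      then show ?thesis using card elim(1) by (simp add: powr_def)
    qed simp
  qed
qed

section \<open>One vanishing error in place of all fixed ones\<close>

theorem theorem1p3:
  fixes k :: nat
    and F :: "'i filter"
    and V :: "'i \<Rightarrow> 'a set" and E :: "'i \<Rightarrow> 'a set set"
    and D q :: "'i \<Rightarrow> nat"
  assumes "k \<ge> 2"
    and "\<And>i. hypergraph (V i) (E i)"
    and "\<And>i. uniform_hypergraph k (E i)"
    and "\<And>i. regular_hypergraph (D i) (V i) (E i)"
    and "filterlim D at_top F"
    and "(\<lambda>i. real (q i)) \<sim>[F] (\<lambda>i. real (D i))"
    and "(\<lambda>i. real (max_codegree (V i) (E i))) \<in> o[F](\<lambda>i. real (q i))"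
  shows "\<exists>\<eta> :: 'i \<Rightarrow> real. \<eta> \<in> o[F](\<lambda>_. 1) \<and>
    (\<forall>\<^sub>F i in F.
       real (card (proper_edge_colorings (q i) (E i)))
         \<le> ((1 + \<eta> i) * (real (q i) / exp (real k)))
              powr (real (D i) * real (card (V i)) / real k))"
proof -
  let ?N = "\<lambda>i. real (card (proper_edge_colorings (q i) (E i)))"
  have "filterlim (\<lambda>i. real (D i)) at_top F"
    by (rule filterlim_compose[OF filterlim_real_sequentially assms(5)])
  then have q_top: "filterlim (\<lambda>i. real (q i)) at_top F"
    using asymp_equiv_at_top_transfer[OF asymp_equiv_symI[OF assms(6)]] by blast
  then have q_pos: "\<forall>\<^sub>F i in F. real (q i) > 0"
    by (rule filterlim_at_top_dense[THEN iffD1, rule_format])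
  have cardE: "real (D i) * real (card (V i)) / real k = real (card (E i))" for i
  proof -
    have "real k * real (card (E i)) = real (D i) * real (card (V i))"
      using card_edges_regular_uniform[OF assms(2-4), of i] by (metis of_nat_mult)
    with assms(1) show ?thesis by (simp add: field_simps)
  qed
  \<comment> \<open>The smallest nonnegative error for which the bound holds.\<close>
  define \<eta> where "\<eta> i = (if card (E i) = 0 then 0
      else max 0 (?N i powr (1 / real (card (E i))) * exp (real k) / real (q i) - 1))" for i
  have "(\<eta> \<longlongrightarrow> 0) F"
  proof (rule order_tendstoI)
    fix a :: real assume "a < 0"
    then show "\<forall>\<^sub>F i in F. a < \<eta> i" by (intro always_eventually) (auto simp: \<eta>_def)
  next
    fix a :: real assume a: "0 < a"
    \<comment> \<open>This choice makes the error factor \<open>exp\<close> of it equal to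
      \<open>1 + a / 2\<close>, leaving room for the strict bound by \<open>a\<close>.\<close>
    then have "ln (1 + a / 2) > 0" by simp
    from eventually_card_proper_edge_colorings_le[OF assms(2-4) q_top assms(6,7) this] q_pos
    show "\<forall>\<^sub>F i in F. \<eta> i < a"
    proof eventually_elim
      case (elim i)
      show ?case
      proof (cases "card (E i) = 0")
        case False
        let ?m = "real (card (E i))"
        have base: "(1 + a / 2) * (real (q i) / exp (real k)) > 0" using a elim(2) by simp
        have "?N i powr (1 / ?m) \<le> (((1 + a / 2) * (real (q i) / exp (real k))) powr ?m) powr (1 / ?m)"
          using elim(1) a by (intro powr_mono2) auto
        also have "\<dots> = (1 + a / 2) * (real (q i) / exp (real k))"
        proof -
          have "?m * (1 / ?m) = 1" using False by simp
          with base show ?thesis by (simp only: powr_powr powr_one less_imp_le)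
        qed
        finally have "?N i powr (1 / ?m) * exp (real k) / real (q i) \<le> 1 + a / 2"
          using elim(2) by (simp add: field_simps)
        then show ?thesis using a False by (auto simp: \<eta>_def)
      qed (use a in \<open>simp add: \<eta>_def\<close>)
    qed
  qed
  then have "\<eta> \<in> o[F](\<lambda>_. 1)" by (intro smalloI_tendsto) auto
  moreover have "\<forall>\<^sub>F i in F. ?N i \<le> ((1 + \<eta> i) * (real (q i) / exp (real k))) powr real (card (E i))"
    using q_pos
  proof eventually_elim
    case (elim i)
    show ?case
    proof (cases "card (E i) = 0")
      case True
      then have "E i = {}" using finite_edges[OF assms(2)] by simp
      \<comment> \<open>There is exactly one coloring, and the right side is 1 only because the base
        is positive: \<open>0 powr 0\<close> is 0.\<close>
      then show ?thesis using elim by (simp add: \<eta>_def proper_edge_colorings_def)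
    next
      case False
      let ?m = "real (card (E i))"
      have "?N i powr (1 / ?m) * exp (real k) / real (q i) \<le> 1 + \<eta> i"
        using False by (auto simp: \<eta>_def)
      then have "?N i powr (1 / ?m) \<le> (1 + \<eta> i) * (real (q i) / exp (real k))"
        using elim by (simp add: field_simps)
      then have "(?N i powr (1 / ?m)) powr ?m \<le> ((1 + \<eta> i) * (real (q i) / exp (real k))) powr ?m"
        by (intro powr_mono2) auto
      then show ?thesis using False by (simp add: powr_powr)
    qed
  qed
  ultimately show ?thesis unfolding cardE by blast
qed

end
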